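(* Let $n, m \geq 1$ and let $\lambda_{n,1},\dots,\lambda_{n,n}$ be the roots of $q_n(x)$. Then $$\prod_{i = 1}^n q_m (\lambda_{n,i}) = \begin{cases} 0 & \text{if } \gcd(n+1,m+1) \neq 1,\\ (-1)^{nm/2} & \text{if } \gcd(n+1,m+1) = 1.\end{cases}$$
   Context: The path $P_n$ is the graph with vertex set $[n]=\{1,\dots,n\}$ and edges $\{i,i+1\}$ for $i \in [n-1]$. For $n \ge 1$, $q_n(x)=\det(\mathbf{A}(P_n)-x\mathbf{I}_n)$, where $\mathbf{A}(P_n)$ is the adjacency matrix of $P_n$ (a polynomial of degree $n$); by convention $q_0(x)=1$. The roots $\lambda_{n,1},\dots,\lambda_{n,n}$ are listed with multiplicity. *)

theory Defs
  imports
    "HOL-Computational_Algebra.Fundamental_Theorem_Algebra"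
    "Jordan_Normal_Form.Char_Poly"
begin

definition path_edges :: "nat \<Rightarrow> nat set set" where
  "path_edges n = {{i, i + 1} | i. i \<in> {1..n - 1}}"

text \<open>
  Matrices are indexed from 0, vertices from 1: row and column \<open>i\<close> belong to the vertex \<open>i + 1\<close>.
\<close>

definition path_adj_mat :: "nat \<Rightarrow> 'a :: comm_ring_1 mat" where
  "path_adj_mat n = mat n n (\<lambda>(i, j). if {i + 1, j + 1} \<in> path_edges n then 1 else 0)"

text \<open>
  The determinant of \<open>A - x I\<close>, computed over the polynomial ring. It differs from
  \<^const>\<open>char_poly\<close>, which is the determinant of \<open>x I - A\<close>, by the sign \<open>(-1) ^ n\<close>.
  The coefficients are complex so that the multiset \<^const>\<open>proots\<close> is guaranteed to contain
  all \<open>n\<close> roots.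
\<close>

definition path_poly :: "nat \<Rightarrow> complex poly" where
  "path_poly n = det (map_mat (\<lambda>a. [:a:]) (path_adj_mat n) - [:0, 1:] \<cdot>\<^sub>m 1\<^sub>m n)"

lemma path_poly_0: "path_poly 0 = 1"
  unfolding path_poly_def path_adj_mat_def by (rule det_dim_zero) auto

lemma path_poly_char_poly:
  "path_poly n = Polynomial.smult ((- 1) ^ n) (char_poly (path_adj_mat n))"
proof -
  have "map_mat (\<lambda>a. [:a:]) (path_adj_mat n) - [:0, 1:] \<cdot>\<^sub>m 1\<^sub>m n =
      (- 1) \<cdot>\<^sub>m char_poly_matrix (path_adj_mat n :: complex mat)"
    by (rule eq_matI) (auto simp: char_poly_matrix_def path_adj_mat_def)
  moreover have "dim_col (char_poly_matrix (path_adj_mat n :: complex mat)) = n"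
    by (simp add: char_poly_matrix_def path_adj_mat_def)
  ultimately have "path_poly n = (- 1) ^ n * char_poly (path_adj_mat n)"
    by (simp add: path_poly_def char_poly_def)
  then show ?thesis
    by (cases "even n") auto
qed

lemma degree_path_poly: "degree (path_poly n) = n"
  using degree_monic_char_poly[of "path_adj_mat n :: complex mat" n]
  by (simp add: path_poly_char_poly path_adj_mat_def)

lemma ex_root_listing:
  "\<exists>\<mu> :: nat \<Rightarrow> complex. image_mset \<mu> (mset_set {1..n}) = proots (path_poly n)"
proof -
  obtain xs where xs: "mset xs = proots (path_poly n)"
    using ex_mset by blast
  then have len: "length xs = n"
    by (metis size_mset size_proots_complex degree_path_poly)
  have "image_mset (\<lambda>i. xs ! (i - 1)) (mset_set {1..n}) =
      image_mset (\<lambda>i. xs ! (i - 1)) (image_mset Suc (mset_set {0..<n}))"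
    by (simp add: image_mset_mset_set image_Suc_atLeastLessThan atLeastLessThanSuc_atLeastAtMost)
  also have "\<dots> = mset (map ((!) xs) [0..<length xs])"
    by (simp add: multiset.map_comp comp_def len)
  also have "\<dots> = proots (path_poly n)"
    by (simp only: map_nth xs)
  finally show ?thesis
    by (intro exI)
qed

end

theory Submission
  imports Defs
begin

text \<open>
  Expanding the determinant gives \<open>q\<^sub>k\<^sub>+\<^sub>2 = - x q\<^sub>k\<^sub>+\<^sub>1 - q\<^sub>k\<close>, hence
  \<open>q\<^sub>m\<^sub>+\<^sub>n\<^sub>+\<^sub>1 = q\<^sub>n q\<^sub>m\<^sub>+\<^sub>1 - q\<^sub>n\<^sub>-\<^sub>1 q\<^sub>m\<close>. Write \<open>R(n, m)\<close> for the product of the values of \<open>q\<^sub>m\<close> at the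
  roots of \<open>q\<^sub>n\<close>. Then \<open>R(n, m + n + 1) = (-1)\<^sup>n R(n, n - 1) R(n, m)\<close>, and as a resultant \<open>R\<close>
  satisfies \<open>R(m, n) = (-1)\<^sup>n\<^sup>m R(n, m)\<close>. The two rules first give the value of \<open>R(n, n - 1)\<close> and
  then reduce \<open>R(n, m)\<close> by the Euclidean algorithm on \<open>(n + 1, m + 1)\<close>, which ends at an index
  \<open>0\<close>, where \<open>R = 1\<close>, or at \<open>n = m\<close>, where \<open>R = 0\<close>.
\<close>

text \<open>The tridiagonal form of \<open>A - x I\<close>, with adjacency read off the indices so
  that minors compare entrywise.\<close>

definition path_char_mat :: "nat \<Rightarrow> complex poly mat" where
  "path_char_mat n = mat n n (\<lambda>(i, j).
     if i = j then [:0, -1:] else if j = Suc i \<or> i = Suc j then 1 else 0)"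

lemma path_char_mat_carrier [simp]: "path_char_mat n \<in> carrier_mat n n"
  by (simp add: path_char_mat_def)

lemma path_edges_iff:
  assumes "i < n" "j < n"
  shows "{i + 1, j + 1} \<in> path_edges n \<longleftrightarrow> j = Suc i \<or> i = Suc j"
proof -
  have "{i + 1, j + 1} \<in> path_edges n" if "j = Suc i"
    unfolding path_edges_def using that assms by (auto intro!: exI[of _ "Suc i"])
  moreover have "{i + 1, j + 1} \<in> path_edges n" if "i = Suc j"
    unfolding path_edges_def using that assms by (auto intro!: exI[of _ "Suc j"])
  moreover have "j = Suc i \<or> i = Suc j" if "{i + 1, j + 1} \<in> path_edges n"
    using that unfolding path_edges_def by (auto simp: doubleton_eq_iff)
  ultimately show ?thesis by blast
qed

lemma path_poly_eq_det: "path_poly n = det (path_char_mat n)"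
proof -
  have "map_mat (\<lambda>a. [:a:]) (path_adj_mat n) - [:0, 1:] \<cdot>\<^sub>m 1\<^sub>m n = path_char_mat n"
  proof (rule eq_matI)
    fix i j assume "i < dim_row (path_char_mat n)" "j < dim_col (path_char_mat n)"
    then have "i < n" "j < n" by (simp_all add: path_char_mat_def)
    then show "(map_mat (\<lambda>a. [:a:]) (path_adj_mat n) - [:0, 1:] \<cdot>\<^sub>m 1\<^sub>m n) $$ (i, j)
        = path_char_mat n $$ (i, j)"
      using path_edges_iff[of i n j] by (auto simp: path_char_mat_def path_adj_mat_def)
  qed (simp_all add: path_char_mat_def path_adj_mat_def)
  then show ?thesis by (simp add: path_poly_def)
qed

lemma path_poly_1: "path_poly (Suc 0) = [:0, -1:]"
  by (simp add: path_poly_eq_det det_single path_char_mat_def)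

lemma path_poly_Suc_Suc:
  "path_poly (Suc (Suc n)) = [:0, -1:] * path_poly (Suc n) - path_poly n"
proof -
  let ?A = "path_char_mat (Suc (Suc n))"
  \<comment> \<open>The minor of the off-diagonal entry in the last row. Its own last column has a
    single nonzero entry, the 1 at the bottom.\<close>
  let ?B = "mat_delete ?A (Suc n) n"
  have "det ?B = (\<Sum>i<Suc n. ?B $$ (i, n) * cofactor ?B i n)"
    by (rule laplace_expansion_column) (auto simp: mat_delete_def path_char_mat_def)
  also have "\<dots> = (\<Sum>i\<in>{n}. ?B $$ (i, n) * cofactor ?B i n)"
    by (rule sum.mono_neutral_right) (auto simp: mat_delete_def path_char_mat_def)
  also have "\<dots> = cofactor ?B n n"
    by (simp add: mat_delete_def path_char_mat_def)
  also have "mat_delete ?B n n = path_char_mat n"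
    by (rule eq_matI) (auto simp: mat_delete_def path_char_mat_def)
  then have "cofactor ?B n n = path_poly n"
    by (simp add: cofactor_def path_poly_eq_det)
  finally have B: "det ?B = path_poly n" .
  have C: "mat_delete ?A (Suc n) (Suc n) = path_char_mat (Suc n)"
    by (rule eq_matI) (auto simp: mat_delete_def path_char_mat_def)
  have "det ?A = (\<Sum>j<Suc (Suc n). ?A $$ (Suc n, j) * cofactor ?A (Suc n) j)"
    by (rule laplace_expansion_row) auto
  also have "\<dots> = (\<Sum>j\<in>{n, Suc n}. ?A $$ (Suc n, j) * cofactor ?A (Suc n) j)"
    by (rule sum.mono_neutral_right) (auto simp: path_char_mat_def)
  also have "\<dots> = cofactor ?A (Suc n) n + [:0, -1:] * cofactor ?A (Suc n) (Suc n)"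
    by (simp add: path_char_mat_def)
  also have "\<dots> = [:0, -1:] * path_poly (Suc n) - path_poly n"
    unfolding cofactor_def B C by (simp add: path_poly_eq_det)
  finally show ?thesis by (simp add: path_poly_eq_det)
qed

text \<open>Both sides satisfy the same three-term recurrence in \<open>k\<close> and agree at
  \<open>k = 0\<close> and \<open>k = 1\<close>.\<close>

lemma path_poly_add:
  "path_poly (Suc n + Suc k) = path_poly (Suc n) * path_poly (Suc k) - path_poly n * path_poly k"
proof (induction k rule: induct_nat_012)
  case 0
  show ?case using path_poly_Suc_Suc[of n] by (simp add: path_poly_0 path_poly_1)
next
  case 1
  show ?case
    by (simp add: path_poly_Suc_Suc path_poly_0 path_poly_1 algebra_simps)
next
  case (ge2 k)
  have "path_poly (Suc n + Suc (Suc (Suc k)))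
      = [:0, -1:] * path_poly (Suc n + Suc (Suc k)) - path_poly (Suc n + Suc k)"
    using path_poly_Suc_Suc[of "Suc n + Suc k"] by simp
  also have "\<dots> = path_poly (Suc n) * ([:0, -1:] * path_poly (Suc (Suc k)) - path_poly (Suc k))
      - path_poly n * ([:0, -1:] * path_poly (Suc k) - path_poly k)"
    unfolding ge2 by (simp only: algebra_simps)
  also have "\<dots> = path_poly (Suc n) * path_poly (Suc (Suc (Suc k)))
      - path_poly n * path_poly (Suc (Suc k))"
    by (simp only: path_poly_Suc_Suc)
  finally show ?case .
qed

lemma path_poly_neq_0: "path_poly n \<noteq> 0"
  using degree_path_poly[of n] path_poly_0 by (cases n) auto

lemma size_proots_path_poly: "size (proots (path_poly n)) = n"
  by (metis size_proots_complex degree_path_poly)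

lemma lead_coeff_path_poly: "lead_coeff (path_poly n) = (- 1) ^ n"
  using degree_monic_char_poly[of "path_adj_mat n :: complex mat" n]
  by (simp add: path_poly_char_poly path_adj_mat_def)

text \<open>The leading coefficient \<open>(- 1) ^ n\<close> is spread over the \<open>n\<close>
  linear factors, turning each \<open>x - a\<close> into \<open>a - x\<close>.\<close>

lemma poly_path_poly_eq_prod_roots:
  "poly (path_poly n) x = (\<Prod>a\<in>#proots (path_poly n). a - x)"
proof -
  have "Polynomial.smult ((- 1) ^ n) (\<Prod>a\<in>#proots (path_poly n). [:- a, 1:]) = path_poly n"
    using complex_poly_decompose_multiset[of "path_poly n"] by (simp add: lead_coeff_path_poly)
  from arg_cong[OF this, of "\<lambda>p. poly p x"]
  have "poly (path_poly n) x = (- 1) ^ n * (\<Prod>a\<in>#proots (path_poly n). x - a)"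
    by (simp add: poly_prod_mset)
  also have "\<dots> = (\<Prod>a\<in>#proots (path_poly n). (- 1) * (x - a))"
    unfolding prod_mset.distrib by (simp add: size_proots_path_poly)
  finally show ?thesis by simp
qed

text \<open>Up to the factor \<open>(- 1) ^ (n * m)\<close>, this is the resultant of the two
  polynomials.\<close>

definition path_res :: "nat \<Rightarrow> nat \<Rightarrow> complex" where
  "path_res n m = (\<Prod>x\<in>#proots (path_poly n). poly (path_poly m) x)"

lemma path_res_0_left [simp]: "path_res 0 m = 1"
  by (simp add: path_res_def path_poly_0)

lemma path_res_0_right [simp]: "path_res n 0 = 1"
  by (simp add: path_res_def path_poly_0)

lemma path_res_self:
  assumes "n \<ge> 1"
  shows "path_res n n = 0"
proof -
  have "proots (path_poly n) \<noteq> {#}"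
    using size_proots_path_poly[of n] assms by auto
  then obtain x where "x \<in># proots (path_poly n)"
    by blast
  moreover from this have "poly (path_poly n) x = 0"
    using path_poly_neq_0[of n] by simp
  ultimately show ?thesis
    unfolding path_res_def by (auto simp: prod_mset_zero_iff)
qed

text \<open>Both are double products of differences of roots; exchanging the roles negates each of
  the \<open>n * m\<close> factors.\<close>

lemma path_res_commute: "path_res m n = (- 1) ^ (n * m) * path_res n m"
proof -
  have "path_res m n = (\<Prod>y\<in>#proots (path_poly m). \<Prod>x\<in>#proots (path_poly n). x - y)"
    by (simp add: path_res_def poly_path_poly_eq_prod_roots)
  also have "\<dots> = (\<Prod>x\<in>#proots (path_poly n). \<Prod>y\<in>#proots (path_poly m). (- 1) * (y - x))"
    by (subst prod_mset.swap) simp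
  also have "\<dots> = (- 1) ^ (n * m) * path_res n m"
    unfolding path_res_def poly_path_poly_eq_prod_roots prod_mset.distrib
    by (simp add: size_proots_path_poly power_mult mult.commute)
  finally show ?thesis .
qed

text \<open>At a root of \<open>path_poly (Suc n)\<close> only the second term of
  \<open>path_poly_add\<close> survives, with one sign for each of the \<open>Suc n\<close>
  roots.\<close>

lemma path_res_add:
  "path_res (Suc n) (Suc n + Suc k) = (- 1) ^ Suc n * path_res (Suc n) n * path_res (Suc n) k"
proof -
  have "path_res (Suc n) (Suc n + Suc k)
      = (\<Prod>x\<in>#proots (path_poly (Suc n)). (- 1) * poly (path_poly n) x * poly (path_poly k) x)"
    unfolding path_res_def
  proof (rule arg_cong[where f = prod_mset], rule image_mset_cong)
    fix x assume "x \<in># proots (path_poly (Suc n))"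
    then have "poly (path_poly (Suc n)) x = 0"
      using path_poly_neq_0[of "Suc n"] by simp
    then show "poly (path_poly (Suc n + Suc k)) x = (- 1) * poly (path_poly n) x * poly (path_poly k) x"
      unfolding path_poly_add by simp
  qed
  then show ?thesis
    unfolding prod_mset.distrib path_res_def by (simp add: size_proots_path_poly)
qed

lemma path_res_Suc_left: "path_res (Suc n) n = (- 1) ^ (Suc n * n div 2)"
proof (induction n)
  case (Suc n)
  \<comment> \<open>The swap costs no sign, as a product of consecutive numbers is even.\<close>
  have "path_res (Suc (Suc n)) (Suc n) = path_res (Suc n) (Suc n + Suc 0)"
    by (simp add: path_res_commute[of "Suc (Suc n)"])
  also have "\<dots> = (- 1) ^ (Suc n + Suc n * n div 2)"
    unfolding path_res_add Suc.IH by (simp add: power_add)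
  also have "Suc n + Suc n * n div 2 = (Suc n * 2 + Suc n * n) div 2"
    by simp
  also have "Suc n * 2 + Suc n * n = Suc (Suc n) * Suc n"
    by simp
  finally show ?case .
qed simp

lemma path_res_add':
  "path_res n (n + Suc k) = (- 1) ^ (Suc n * n div 2) * path_res n k"
proof (cases n)
  case (Suc l)
  have "(Suc n * n) div 2 = (Suc l * 2 + Suc l * l) div 2"
    by (simp add: Suc)
  also have "\<dots> = Suc l + Suc l * l div 2"
    by simp
  finally show ?thesis
    unfolding Suc path_res_add path_res_Suc_left by (simp add: power_add)
qed simp

lemma path_res_eq:
  "path_res n m = (if coprime (n + 1) (m + 1) then (- 1) ^ (n * m div 2) else 0)"
proof (induction "n + m" arbitrary: n m rule: less_induct)
  case less
  \<comment> \<open>One subtraction step of Euclid: \<open>b + 1 = (a + 1) + (k + 1)\<close>. It is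
    stated for \<open>a\<close>, \<open>b\<close> so that it serves \<open>(n, m)\<close> and
    \<open>(m, n)\<close> alike.\<close>
  have step: "path_res a b = (if coprime (a + 1) (b + 1) then (- 1) ^ (a * b div 2) else 0)"
    if "a < b" "a + b = n + m" for a b
  proof -
    obtain k where b: "b = a + Suc k"
      using \<open>a < b\<close> less_iff_Suc_add by auto
    have gcd: "coprime (a + 1) (b + 1) \<longleftrightarrow> coprime (a + 1) (k + 1)"
      using gcd_add2[of "a + 1" "k + 1"] by (simp add: b coprime_iff_gcd_eq_1)
    \<comment> \<open>The halves add up without rounding loss because \<open>Suc a * a\<close> is
      even.\<close>
    have "Suc a * a div 2 + a * k div 2 = a * b div 2"
    proof -
      have "a * b = Suc a * a + a * k" by (simp add: b algebra_simps)
      then show ?thesis by (simp add: div_plus_div_distrib_dvd_left)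
    qed
    then have "path_res a b = (- 1) ^ (Suc a * a div 2) * path_res a k
        \<and> a * b div 2 = Suc a * a div 2 + a * k div 2"
      by (simp only: b path_res_add')
    then show ?thesis
      using less[of a k] that gcd by (auto simp: b power_add)
  qed
  consider "n < m" | "m < n" | "n = m" "n = 0" | "n = m" "n \<ge> 1" by linarith
  then show ?case
  proof cases
    case 2
    \<comment> \<open>Coprime \<open>n + 1\<close> and \<open>m + 1\<close> are not both even, so
      the swap sign is 1; otherwise the value is 0 and the sign is harmless.\<close>
    have "even (n * m)" if "coprime (n + 1) (m + 1)"
      using that coprime_common_divisor_nat[of "n + 1" "m + 1" 2] by auto
    then show ?thesis
      using step[of m n] 2 path_res_commute[of n m]
      by (auto simp: coprime_commute mult.commute add.commute)
  qed (use step[of n m] path_res_self[of n] in auto)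
qed

theorem theorem6:
  fixes n m :: nat and \<mu> :: "nat \<Rightarrow> complex"
  assumes "n \<ge> 1" and "m \<ge> 1"
    and "image_mset \<mu> (mset_set {1..n}) = proots (path_poly n)"
  shows "(\<Prod>i = 1..n. poly (path_poly m) (\<mu> i)) =
    (if gcd (n + 1) (m + 1) \<noteq> 1 then 0 else (- 1) ^ (n * m div 2))"
proof -
  have "(\<Prod>i = 1..n. poly (path_poly m) (\<mu> i)) = path_res n m"
    unfolding path_res_def assms(3)[symmetric]
    by (simp add: prod_unfold_prod_mset multiset.map_comp comp_def)
  then show ?thesis
    by (simp add: path_res_eq coprime_iff_gcd_eq_1)
qed

end
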